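(* Let $d_{\mathrm v}\ge 3$ and $d_{\mathrm c}\ge 2$ be integers and let $R\in(0,1]$ be the rate of a $(d_{\mathrm v},d_{\mathrm c})$-regular binary LDPC code. For $E_{\mathrm b}/N_0>0$ let $m_\lambda=4R\,E_{\mathrm b}/N_0$ and let $(m^{(l)})_{l\ge 0}$ be the sequence of check-node output means predicted by (Gaussian-approximation) density evolution, i.e. $m^{(0)}=0$ and, for $l\ge1$, $$m^{(l)}=\phi^{-1}\left(1-\left[1-\phi\left(m_\lambda+(d_{\mathrm v}-1)m^{(l-1)}\right)\right]^{d_{\mathrm c}-1}\right).$$ Then for all sufficiently high $E_{\mathrm b}/N_0$ the sequence $m^{(l)}$ asymptotically dominates $(d_{\mathrm v}-1)^l$ after a finite number of iterations. That is, there is a threshold $s_0$ such that for every $E_{\mathrm b}/N_0>s_0$ there exist a real $C>0$ and a finite iteration index $L$ with $$m^{(l)}>C\,(d_{\mathrm v}-1)^l\qquad\text{for all } l\ge L.$$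
   Context: Setting: a $(d_{\mathrm v},d_{\mathrm c})$-regular binary LDPC code (every variable node of the Tanner graph has degree $d_{\mathrm v}$, every check node degree $d_{\mathrm c}$) with binary antipodal signaling over the additive white Gaussian noise channel, decoded by the log-likelihood-ratio (LLR) domain sum-product algorithm without saturation. The channel quality is $E_{\mathrm b}/N_0$ (a positive real, on a linear scale), $R$ is the code rate, and the mean channel LLR is $m_\lambda=4R\,E_{\mathrm b}/N_0$. "Density evolution" means the consistent Gaussian approximation to density evolution, in which the mean $m^{(l)}$ of the check-node output LLR at iteration $l$ evolves by the recursion in the claim. The function $\phi:[0,\infty)\to(0,1]$ is $$\phi(x)=\begin{cases}1-\dfrac{1}{\sqrt{4\pi x}}\displaystyle\int_{\mathbb R}\tanh\frac u2\; e^{-\frac{(u-x)^2}{4x}}\,du,& x>0,\\[2mm] 1,& x=0.\end{cases}$$ It is continuous and strictly decreasing from $1$ (at $x=0$) to $0$ (as $x\to\infty$), and $\phi^{-1}:(0,1]\to[0,\infty)$ is its inverse. *)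

theory Defs
  imports "HOL-Analysis.Analysis" "HOL-Library.Z2"
begin

definition regular_ldpc :: "nat \<Rightarrow> nat \<Rightarrow> 'v set \<Rightarrow> 'c set \<Rightarrow> ('v \<times> 'c) set \<Rightarrow> bool" where
  "regular_ldpc dv dc V K E \<longleftrightarrow>
     finite V \<and> V \<noteq> {} \<and> finite K \<and> E \<subseteq> V \<times> K \<and>
     (\<forall>v\<in>V. card {c. (v, c) \<in> E} = dv) \<and>
     (\<forall>c\<in>K. card {v. (v, c) \<in> E} = dc)"

definition codewords :: "'v set \<Rightarrow> 'c set \<Rightarrow> ('v \<times> 'c) set \<Rightarrow> ('v \<Rightarrow> bit) set" where
  "codewords V K E =
     {x \<in> V \<rightarrow>\<^sub>E UNIV. \<forall>c\<in>K. (\<Sum>v | (v, c) \<in> E. x v) = 0}"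

text \<open>The true rate (dimension over block length), not the design rate
  \<open>1 - dv / dc\<close>; the two differ when the checks are linearly dependent.\<close>

definition code_rate :: "'v set \<Rightarrow> 'c set \<Rightarrow> ('v \<times> 'c) set \<Rightarrow> real" where
  "code_rate V K E = log 2 (real (card (codewords V K E))) / real (card V)"

text \<open>Only arguments \<open>x \<ge> 0\<close> are meaningful.\<close>

definition phi :: "real \<Rightarrow> real" where
  "phi x =
     (if x > 0
      then 1 - 1 / sqrt (4 * pi * x) *
             (LINT u|lborel. tanh (u / 2) * exp (- ((u - x)\<^sup>2 / (4 * x))))
      else 1)"

definition phi_inv :: "real \<Rightarrow> real" where
  "phi_inv = inv_into {0..} phi"

definition channel_llr_mean :: "real \<Rightarrow> real \<Rightarrow> real" where
  "channel_llr_mean R s = 4 * R * s"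

primrec check_mean :: "nat \<Rightarrow> nat \<Rightarrow> real \<Rightarrow> nat \<Rightarrow> real" where
  "check_mean dv dc mu 0 = 0"
| "check_mean dv dc mu (Suc l) =
     phi_inv (1 - (1 - phi (mu + (real dv - 1) * check_mean dv dc mu l)) ^ (dc - 1))"

end

theory Submission
  imports Defs "HOL-Probability.Distributions"
begin

text \<open>
  Since \<open>1 - tanh (u / 2) = exp (- u / 2) / cosh (u / 2)\<close>, completing the square and rescaling
  by the standard deviation \<open>sqrt (2 * x)\<close> gives \<open>phi x = exp (- x / 4) * h x\<close>, where
  \<open>h x\<close> is the expectation of \<open>1 / cosh (sqrt (2 * x) * Z / 2)\<close> for a standard
  normal \<open>Z\<close>. As \<open>h\<close> is positive, decreasing and continuous, \<open>phi\<close> is a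
  strictly decreasing bijection onto \<open>(0, 1]\<close>, and \<open>phi (y - d) \<ge> exp (d / 4) * phi y\<close>.
  With \<open>n = dc - 1\<close> and \<open>d = 4 * ln n\<close>, Bernoulli's inequality gives
  \<open>1 - (1 - phi y) ^ n \<le> n * phi y \<le> phi (y - d)\<close>, so one iteration maps a mean \<open>m\<close>
  to at least \<open>(mu - d) + (dv - 1) * m\<close>, which grows geometrically once \<open>mu > d\<close>.
\<close>

definition sech_mean :: "real \<Rightarrow> real" where
  "sech_mean x = (LINT z|lborel. std_normal_density z / cosh (sqrt (2 * x) / 2 * z))"

text \<open>As \<open>cosh\<close> is at least 1, the normal density is a majorant that does not
  depend on \<open>w\<close>. This serves both integrability and dominated convergence.\<close>

lemma norm_density_div_cosh_le:
  "norm (std_normal_density z / cosh w) \<le> std_normal_density z"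
proof -
  have "std_normal_density z / cosh w \<le> std_normal_density z / 1"
    by (intro divide_left_mono) (auto simp: cosh_real_ge_1)
  then show ?thesis by simp
qed

lemma integrable_sech_density:
  "integrable lborel (\<lambda>z. std_normal_density z / cosh (a * z))"
proof (rule Bochner_Integration.integrable_bound[OF integrable_normal_density[of 1 0]])
  show "(\<lambda>z. std_normal_density z / cosh (a * z)) \<in> borel_measurable lborel"
    unfolding cosh_def by measurable
  show "AE z in lborel. norm (std_normal_density z / cosh (a * z)) \<le> norm (std_normal_density z)"
    using norm_density_div_cosh_le by (intro always_eventually allI) auto
qed simp

lemma one_minus_tanh_real: "1 - tanh x = exp (- x) / cosh (x :: real)"
  by (simp add: tanh_def cosh_minus_sinh [symmetric] diff_divide_distrib)

lemma phi_eq: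
  assumes "0 \<le> x"
  shows "phi x = exp (- x / 4) * sech_mean x"
proof (cases "x = 0")
  case True
  then show ?thesis
    using integral_normal_density[of 1 0] by (simp add: phi_def sech_mean_def)
next
  case False
  with assms have x: "x > 0" by simp
  \<comment> \<open>The Gaussian in \<open>phi\<close> has mean \<open>x\<close> and variance
    \<open>2 * x\<close>, so \<open>c\<close> is its standard deviation.\<close>
  define c where "c = sqrt (2 * x)"
  have c: "c > 0" and c2: "c\<^sup>2 = 2 * x" using x by (auto simp: c_def)
  have nd: "normal_density x c u = 1 / sqrt (4 * pi * x) * exp (- ((u - x)\<^sup>2 / (4 * x)))" for u
    by (simp add: normal_density_def c2 mult_ac)
  have int1: "integrable lborel (normal_density x c)"
    using c by (rule integrable_normal_density)
  have int2: "integrable lborel (\<lambda>u. tanh (u / 2) * normal_density x c u)"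
  proof (rule Bochner_Integration.integrable_bound[OF int1])
    show "(\<lambda>u. tanh (u / 2) * normal_density x c u) \<in> borel_measurable lborel"
      unfolding tanh_def sinh_def cosh_def by measurable
    have "\<bar>tanh v\<bar> \<le> 1" for v :: real
      using tanh_real_bounds[of v] by auto
    then show "AE u in lborel. norm (tanh (u / 2) * normal_density x c u) \<le> norm (normal_density x c u)"
      by (auto simp: abs_mult intro!: mult_left_le_one_le)
  qed
  \<comment> \<open>Tilting this Gaussian by \<open>exp (- u / 2)\<close> moves its mean from
    \<open>x\<close> to 0. Hence \<open>u = c * z\<close> is substituted without a shift; the
    leading \<open>c\<close> is the Jacobian.\<close>
  have density: "c * ((1 - tanh (c * z / 2)) * normal_density x c (c * z)) =
      exp (- x / 4) * (std_normal_density z / cosh (c / 2 * z))" for z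
  proof -
    have "(c * z - x)\<^sup>2 = 2 * x * z\<^sup>2 - 2 * x * (c * z) + x\<^sup>2"
      by (simp add: c2 power2_diff power_mult_distrib algebra_simps)
    then have "- ((c * z - x)\<^sup>2 / (2 * c\<^sup>2)) = - z\<^sup>2 / 2 + c * z / 2 - x / 4"
      using x by (simp only: c2) (simp add: field_simps power2_eq_square)
    then have "exp (- ((c * z - x)\<^sup>2 / (2 * c\<^sup>2))) =
        exp (- x / 4) * exp (- z\<^sup>2 / 2) * exp (c * z / 2)"
      by (simp add: exp_add [symmetric])
    then have "normal_density x c (c * z) =
        exp (- x / 4) * std_normal_density z * exp (c * z / 2) / c"
      using c by (simp add: normal_density_def std_normal_density_def real_sqrt_mult)
    then show ?thesis
      using c by (simp add: one_minus_tanh_real exp_minus field_simps)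
  qed
  have "phi x = 1 - (LINT u|lborel. 1 / sqrt (4 * pi * x) * (tanh (u / 2) * exp (- ((u - x)\<^sup>2 / (4 * x)))))"
    using x by (simp only: phi_def if_True integral_mult_right_zero)
  also have "\<dots> = (LINT u|lborel. normal_density x c u) -
      (LINT u|lborel. tanh (u / 2) * normal_density x c u)"
    by (subst integral_normal_density[OF c]) (simp only: nd mult.left_commute)
  also have "\<dots> = (LINT u|lborel. (1 - tanh (u / 2)) * normal_density x c u)"
    by (subst Bochner_Integration.integral_diff [OF int1 int2, symmetric])
       (simp only: left_diff_distrib mult_1_left)
  also have "\<dots> = \<bar>c\<bar> *\<^sub>R (LINT z|lborel. (1 - tanh ((0 + c * z) / 2)) * normal_density x c (0 + c * z))"
    using c by (intro lborel_integral_real_affine) simp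
  also have "\<dots> = (LINT z|lborel. c * ((1 - tanh (c * z / 2)) * normal_density x c (c * z)))"
    using c by simp
  also have "\<dots> = exp (- x / 4) * sech_mean x"
    by (simp only: density integral_mult_right_zero) (simp only: sech_mean_def c_def)
  finally show ?thesis .
qed

text \<open>If the integral vanished, the positive integrand would be zero almost everywhere, which
  is impossible because Lebesgue measure is not the zero measure.\<close>

lemma sech_mean_pos: "0 < sech_mean x"
proof -
  let ?f = "\<lambda>z. std_normal_density z / cosh (sqrt (2 * x) / 2 * z)"
  have pos: "0 < ?f z" for z by (simp add: normal_density_pos)
  have "sech_mean x \<noteq> 0"
  proof
    assume "sech_mean x = 0"
    then have "AE z in lborel. ?f z = 0"
      unfolding sech_mean_def
      using integral_nonneg_eq_0_iff_AE[OF integrable_sech_density, of "sqrt (2 * x) / 2"] by simp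
    then have "AE z in (lborel :: real measure). False"
      by (rule AE_mp) (use pos in \<open>auto simp: less_le\<close>)
    then show False
      by (simp add: trivial_limit_def [symmetric] ae_filter_eq_bot_iff)
  qed
  moreover have "0 \<le> sech_mean x"
    unfolding sech_mean_def using pos by (intro integral_nonneg_AE) (auto simp: less_imp_le)
  ultimately show ?thesis by simp
qed

lemma sech_mean_antimono:
  assumes "0 \<le> x" "x \<le> y"
  shows "sech_mean y \<le> sech_mean x"
  unfolding sech_mean_def
proof (rule integral_mono[OF integrable_sech_density integrable_sech_density])
  fix z :: real
  \<comment> \<open>\<open>cosh\<close> is increasing only on nonnegative arguments and
    \<open>z\<close> may be negative, hence the absolute values.\<close>
  have "cosh \<bar>sqrt (2 * x) / 2 * z\<bar> \<le> cosh \<bar>sqrt (2 * y) / 2 * z\<bar>"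
    using assms by (subst cosh_real_nonneg_le_iff) (auto simp: abs_mult intro!: mult_right_mono)
  then show "std_normal_density z / cosh (sqrt (2 * y) / 2 * z) \<le>
      std_normal_density z / cosh (sqrt (2 * x) / 2 * z)"
    by (intro divide_left_mono) (auto simp only: cosh_real_abs cosh_real_pos mult_pos_pos normal_density_nonneg)
qed

text \<open>Dominated convergence along sequences. The whole line is covered because
  \<open>sqrt\<close> extends to negative arguments as a continuous odd function.\<close>

lemma continuous_on_sech_mean: "continuous_on UNIV sech_mean"
proof (rule continuous_at_imp_continuous_on, intro ballI)
  fix x :: real
  show "isCont sech_mean x"
    unfolding continuous_at_sequentially comp_def
  proof (intro allI impI)
    fix X :: "nat \<Rightarrow> real"
    assume X: "X \<longlonglongrightarrow> x"
    show "(\<lambda>i. sech_mean (X i)) \<longlonglongrightarrow> sech_mean x"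
      unfolding sech_mean_def
    proof (rule integral_dominated_convergence[where w = std_normal_density])
      show "integrable lborel std_normal_density" by simp
      show "AE z in lborel. (\<lambda>i. std_normal_density z / cosh (sqrt (2 * X i) / 2 * z))
          \<longlonglongrightarrow> std_normal_density z / cosh (sqrt (2 * x) / 2 * z)"
        using X by (auto intro!: tendsto_intros)
      show "AE z in lborel. norm (std_normal_density z / cosh (sqrt (2 * X i) / 2 * z))
          \<le> std_normal_density z" for i
        using norm_density_div_cosh_le by (intro always_eventually allI) auto
    qed (use integrable_sech_density in blast)+
  qed
qed

lemma phi_0: "phi 0 = 1"
  by (simp add: phi_def)

lemma phi_pos: "0 \<le> x \<Longrightarrow> 0 < phi x"
  by (simp add: phi_eq sech_mean_pos)

text \<open>The exponential factor of \<open>phi\<close> gains exactly \<open>exp (d / 4)\<close>,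
  and the decreasing factor \<open>sech_mean\<close> can only add to this.\<close>

lemma phi_shift_ge:
  assumes "0 \<le> d" "d \<le> y"
  shows "exp (d / 4) * phi y \<le> phi (y - d)"
proof -
  have "exp (d / 4) * phi y = exp (- (y - d) / 4) * sech_mean y"
    using assms by (simp add: phi_eq exp_add [symmetric] diff_divide_distrib)
  also have "\<dots> \<le> exp (- (y - d) / 4) * sech_mean (y - d)"
    using assms by (intro mult_left_mono sech_mean_antimono) auto
  finally show ?thesis using assms by (simp add: phi_eq)
qed

lemma phi_strict_antimono:
  assumes "0 \<le> x" "x < y"
  shows "phi y < phi x"
proof -
  have "1 * phi y < exp ((y - x) / 4) * phi y"
    using assms phi_pos[of y] by (intro mult_strict_right_mono) auto
  also have "\<dots> \<le> phi x"
    using assms phi_shift_ge[of "y - x" y] by simp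
  finally show ?thesis by simp
qed

lemma phi_surj:
  assumes "0 < q" "q \<le> 1"
  obtains x where "0 \<le> x" "phi x = q"
proof -
  \<comment> \<open>Chosen so that \<open>exp (- b / 4) = q\<close>; shifting from \<open>b\<close>
    down to 0 then gives \<open>phi b \<le> q\<close>, the lower end for the intermediate value
    theorem.\<close>
  define b where "b = - 4 * ln q"
  have b: "0 \<le> b" using assms by (simp add: b_def)
  have "exp (b / 4) * phi b \<le> 1"
    using phi_shift_ge[of b b] b by (simp add: phi_0)
  then have "phi b \<le> q"
    using assms by (simp add: b_def exp_minus field_simps)
  moreover have "continuous_on {0..b} phi"
    by (subst continuous_on_cong[OF refl phi_eq])
       (auto intro!: continuous_intros continuous_on_subset[OF continuous_on_sech_mean])
  ultimately show ?thesis
    using IVT2'[of phi b q 0] assms b that by (auto simp: phi_0)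
qed

lemma phi_inv_works:
  assumes "0 < q" "q \<le> 1"
  shows "0 \<le> phi_inv q" "phi (phi_inv q) = q"
proof -
  have "q \<in> phi ` {0..}"
    using phi_surj[OF assms] by (metis atLeast_iff image_eqI)
  then show "0 \<le> phi_inv q" "phi (phi_inv q) = q"
    unfolding phi_inv_def using inv_into_into f_inv_into_f by (metis atLeast_iff)+
qed

lemma phi_inv_update_ge:
  assumes "1 \<le> n" "4 * ln (real n) \<le> y"
  shows "y - 4 * ln (real n) \<le> phi_inv (1 - (1 - phi y) ^ n)"
proof -
  define q where "q = 1 - (1 - phi y) ^ n"
  have y: "0 \<le> y" using assms by (smt (verit) ln_ge_zero of_nat_1 of_nat_le_iff)
  have p: "0 < phi y" "phi y \<le> 1"
    using phi_pos[OF y] phi_strict_antimono[of 0 y] y by (auto simp: phi_0 less_eq_real_def)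
  have "(1 - phi y) ^ n < 1"
    using p assms by (intro power_less_one_iff[THEN iffD2]) auto
  moreover have "0 \<le> (1 - phi y) ^ n" using p by simp
  ultimately have q: "0 < q" "q \<le> 1" by (auto simp: q_def)
  have "q \<le> real n * phi y"
    using Bernoulli_inequality[of "- phi y" n] p by (simp add: q_def)
  also have "\<dots> \<le> phi (y - 4 * ln (real n))"
    using phi_shift_ge[of "4 * ln (real n)" y] assms by simp
  finally have "phi (phi_inv q) \<le> phi (y - 4 * ln (real n))"
    using phi_inv_works[OF q] by simp
  \<comment> \<open>Contrapositive of strict monotonicity: a smaller \<open>phi_inv q\<close> would
    have a larger value of \<open>phi\<close>.\<close>
  then show ?thesis
    using phi_strict_antimono[of "phi_inv q" "y - 4 * ln (real n)"] phi_inv_works(1)[OF q]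
    by (fold q_def) linarith
qed

text \<open>The exponent lags one behind the iteration because the recursion starts at 0: the first
  iteration yields the surplus of \<open>mu\<close> over the loss, and each later one multiplies by
  at least \<open>dv - 1\<close>.\<close>

lemma check_mean_Suc_ge:
  assumes "1 \<le> dv" "2 \<le> dc" and mu: "4 * ln (real (dc - 1)) \<le> mu"
  shows "(mu - 4 * ln (real (dc - 1))) * (real dv - 1) ^ l \<le> check_mean dv dc mu (Suc l)"
proof -
  define \<epsilon> where "\<epsilon> = mu - 4 * ln (real (dc - 1))"
  have \<epsilon>: "0 \<le> \<epsilon>" using mu by (simp add: \<epsilon>_def)
  have step: "\<epsilon> + (real dv - 1) * check_mean dv dc mu l \<le> check_mean dv dc mu (Suc l)"
    if "0 \<le> check_mean dv dc mu l" for l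
  proof -
    have "0 \<le> (real dv - 1) * check_mean dv dc mu l" using that assms(1) by simp
    then show ?thesis
      using phi_inv_update_ge[of "dc - 1" "mu + (real dv - 1) * check_mean dv dc mu l"] assms(2) mu
      unfolding \<epsilon>_def check_mean.simps by linarith
  qed
  have "\<epsilon> * (real dv - 1) ^ l \<le> check_mean dv dc mu (Suc l)"
  proof (induction l)
    case 0
    then show ?case using step[of 0] by simp
  next
    case (Suc l)
    \<comment> \<open>Nonnegativity of the mean keeps the next argument of \<open>phi\<close> above
      the loss, as \<open>step\<close> requires.\<close>
    have "0 \<le> \<epsilon> * (real dv - 1) ^ l" using \<epsilon> assms(1) by simp
    with Suc have nonneg: "0 \<le> check_mean dv dc mu (Suc l)" by linarith
    have "\<epsilon> * (real dv - 1) ^ Suc l = (real dv - 1) * (\<epsilon> * (real dv - 1) ^ l)" by simp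
    also have "\<dots> \<le> (real dv - 1) * check_mean dv dc mu (Suc l)"
      using Suc assms(1) by (intro mult_left_mono) auto
    finally show ?case using step[OF nonneg] \<epsilon> by linarith
  qed
  then show ?thesis by (simp add: \<epsilon>_def)
qed

theorem theorem3:
  fixes dv dc :: nat and R :: real
    and V :: "'v set" and K :: "'c set" and E :: "('v \<times> 'c) set"
  assumes "dv \<ge> 3" and "dc \<ge> 2"
    and "regular_ldpc dv dc V K E"
    and "R = code_rate V K E" and "0 < R" and "R \<le> 1"
  shows "\<exists>s0::real. \<forall>s>s0. 0 < s \<longrightarrow>
           (\<exists>C>0. \<exists>L. \<forall>l\<ge>L.
              check_mean dv dc (channel_llr_mean R s) l > C * (real dv - 1) ^ l)"
proof (rule exI[of _ "ln (real (dc - 1)) / R"], intro allI impI)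
  fix s :: real
  assume "ln (real (dc - 1)) / R < s"
  define mu where "mu = channel_llr_mean R s"
  define \<epsilon> where "\<epsilon> = mu - 4 * ln (real (dc - 1))"
  \<comment> \<open>Halving makes the final inequality strict; dividing by \<open>dv - 1\<close>
    absorbs the lag of one iteration.\<close>
  define C where "C = \<epsilon> / 2 / (real dv - 1)"
  \<comment> \<open>The threshold for \<open>s\<close> is the point where
    \<open>mu = 4 * R * s\<close> equals the loss \<open>4 * ln (dc - 1)\<close>.\<close>
  have \<epsilon>: "0 < \<epsilon>"
    using \<open>ln (real (dc - 1)) / R < s\<close> \<open>0 < R\<close>
    by (simp add: \<epsilon>_def mu_def channel_llr_mean_def field_simps)
  have C_mult: "C * (real dv - 1) = \<epsilon> / 2"
    by (rule nonzero_eq_divide_eq[THEN iffD1, OF _ C_def]) (use assms(1) in simp)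
  \<comment> \<open>The bound starts at \<open>L = 1\<close>, since the mean at iteration 0 is
    0.\<close>
  have "C * (real dv - 1) ^ l < check_mean dv dc mu l" if "1 \<le> l" for l
  proof -
    obtain k where l: "l = Suc k" using \<open>1 \<le> l\<close> by (cases l) auto
    have "C * (real dv - 1) ^ l = \<epsilon> / 2 * (real dv - 1) ^ k"
      by (simp only: l power_Suc mult.assoc [symmetric] C_mult)
    also have "\<dots> < \<epsilon> * (real dv - 1) ^ k"
      using \<epsilon> assms(1) by (intro mult_strict_right_mono) auto
    also have "\<dots> \<le> check_mean dv dc mu l"
      using check_mean_Suc_ge[of dv dc mu k] assms \<epsilon> by (simp add: \<epsilon>_def l)
    finally show ?thesis .
  qed
  moreover have "0 < C" using \<epsilon> assms(1) by (simp add: C_def)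
  ultimately show "\<exists>C>0. \<exists>L. \<forall>l\<ge>L.
      check_mean dv dc (channel_llr_mean R s) l > C * (real dv - 1) ^ l"
    unfolding mu_def by blast
qed

end
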